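(* Let $S$ be a finite alphabet and $X \subset S^{\mathbb{N}}$ a subshift. Then $X$ is quasiminimal if and only if there exist finitely many minimal subshifts $Y_1, Y_2, \ldots, Y_k$ and finitely many points $x_1, \ldots, x_\ell$ such that $X = \bigcup_i Y_i \cup \{x_1, \ldots, x_\ell\}$ and such that for all $i \in [1, \ell]$, either $\sigma(x_i) \in \bigcup_j Y_j$ or $\sigma(x_i) \in \{x_{i+1}, \ldots, x_\ell\}$.
   Context: Give $S^{\mathbb{N}}$ the product topology and the shift $\sigma(x)_i = x_{i+1}$. A subshift in $S^{\mathbb{N}}$ is a closed set $X$ with $\sigma(X) \subset X$ (surjectivity is not required); a subshift of $X$ is a subshift $Y\subset X$. A minimal subshift is one whose only subshifts are $\emptyset$ and itself. $X$ is quasiminimal if it has finitely many proper subshifts. The lists of minimal subshifts and of points may be empty. *)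

theory Defs
  imports "HOL-Analysis.Function_Topology"
begin

definition full_shift :: "'a set \<Rightarrow> (nat \<Rightarrow> 'a) topology" where
  "full_shift S = product_topology (\<lambda>_. discrete_topology S) UNIV"

definition shift :: "(nat \<Rightarrow> 'a) \<Rightarrow> (nat \<Rightarrow> 'a)" where
  "shift x = (\<lambda>i. x (i + 1))"

definition subshift :: "'a set \<Rightarrow> (nat \<Rightarrow> 'a) set \<Rightarrow> bool" where
  "subshift S X \<longleftrightarrow> closedin (full_shift S) X \<and> shift ` X \<subseteq> X"

text \<open>The empty subshift counts as minimal, and as a proper subshift of every
  nonempty subshift.\<close>

definition minimal_subshift :: "'a set \<Rightarrow> (nat \<Rightarrow> 'a) set \<Rightarrow> bool" where
  "minimal_subshift S X \<longleftrightarrow>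
     subshift S X \<and> (\<forall>Y. subshift S Y \<and> Y \<subseteq> X \<longrightarrow> Y = {} \<or> Y = X)"

definition quasiminimal :: "'a set \<Rightarrow> (nat \<Rightarrow> 'a) set \<Rightarrow> bool" where
  "quasiminimal S X \<longleftrightarrow> subshift S X \<and> finite {Y. subshift S Y \<and> Y \<subset> X}"

end

theory Submission
  imports Defs "HOL-Analysis.T1_Spaces"
begin

text \<open>
  If \<open>X\<close> is a finite union of minimal subshifts \<open>Y\<^sub>i\<close> and a finite set \<open>F\<close>, then a subshift of \<open>X\<close>
  contains each \<open>Y\<^sub>i\<close> entirely or misses it, so it is determined by the \<open>Y\<^sub>i\<close> it contains and by its
  intersection with \<open>F\<close>; there are finitely many possibilities
  (\<open>decomposition_imp_quasiminimal\<close>).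

  Conversely, let \<open>X\<close> be quasiminimal and let \<open>M\<close> be the union of the finitely many minimal
  subshifts of \<open>X\<close>. The orbit closures of \<open>x, \<sigma> x, \<sigma>\<^sup>2 x, \<dots>\<close> form a decreasing sequence of subshifts,
  so two of them agree, and from then on the orbit consists of points \<open>y\<close> in the orbit closure
  of \<open>\<sigma> y\<close>. The heart of the proof is that the orbit closure \<open>W\<close> of such a recurrent \<open>y\<close> is
  minimal (\<open>minimal_orbit_closure_recurrent\<close>). Since every point of \<open>X\<close> then reaches \<open>M\<close>, the
  map sending \<open>x\<close> outside \<open>M\<close> to the subshift \<open>M \<union> {x, \<sigma> x, \<dots>}\<close> is injective: two points with the
  same image lie on each other's orbit, and a periodic point outside \<open>M\<close> would never reach \<open>M\<close>.
  Hence only finitely many points lie outside \<open>M\<close> (\<open>finite_outside_absorbing_subshift\<close>), and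
  listing them by decreasing time of entry into \<open>M\<close> puts \<open>\<sigma> x\<^sub>i\<close> after \<open>x\<^sub>i\<close> or into \<open>M\<close>.

  For minimality, suppose that \<open>Z\<close> is a nonempty proper subshift of \<open>W\<close>. Recurrence and compactness
  make \<open>\<sigma>\<close> map \<open>W\<close> onto itself. The subshifts \<open>W \<inter> \<sigma>\<^sup>-\<^sup>n Z\<close> cannot all be different, and by
  surjectivity this forces \<open>W \<inter> \<sigma>\<^sup>-\<^sup>1 Z = Z\<close> (\<open>backward_invariant_in_surjective\<close>). Finiteness also
  yields a clopen neighbourhood \<open>U\<close> of \<open>Z\<close> that misses \<open>y\<close> and such that only points of \<open>Z\<close> have their
  whole orbit in \<open>U\<close> (\<open>isolating_clopen_nbhd\<close>). The orbit of \<open>y\<close> starts outside \<open>U\<close> but comes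
  arbitrarily close to \<open>Z\<close>, hence makes arbitrarily long visits to \<open>U\<close>. The points just before these
  visits accumulate, by compactness, at a point \<open>w\<close> outside \<open>U\<close> for which \<open>\<sigma> w\<close> has its orbit in \<open>U\<close>,
  so that \<open>\<sigma> w\<close> lies in \<open>Z\<close> although \<open>w\<close> does not: a contradiction.
\<close>

section \<open>The topology of the full shift\<close>

lemma compact_space_full_shift: "finite S \<Longrightarrow> compact_space (full_shift S)"
  by (simp add: full_shift_def compact_space_product_topology compact_space_discrete_topology)

lemma Hausdorff_space_full_shift: "Hausdorff_space (full_shift S)"
  by (simp add: full_shift_def Hausdorff_space_product_topology Hausdorff_space_discrete_topology)

lemma continuous_map_shift: "continuous_map (full_shift S) (full_shift S) shift"
  unfolding full_shift_def continuous_map_componentwise_UNIV shift_def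
  by (auto intro: continuous_map_product_projection)

lemma continuous_map_shift_funpow:
  "continuous_map (full_shift S) (full_shift S) (shift ^^ n)"
proof (induction n)
  case (Suc n)
  then show ?case
    using continuous_map_compose[OF Suc continuous_map_shift] by (simp add: o_def)
qed (simp add: id_def)

lemma closedin_shift_preimage:
  assumes "closedin (full_shift S) C"
  shows "closedin (full_shift S) {x \<in> topspace (full_shift S). (shift ^^ n) x \<in> C}"
  by (rule closedin_continuous_map_preimage[OF continuous_map_shift_funpow assms])

lemma openin_shift_preimage:
  assumes "openin (full_shift S) U"
  shows "openin (full_shift S) {x \<in> topspace (full_shift S). (shift ^^ n) x \<in> U}"
  by (rule openin_continuous_map_preimage[OF continuous_map_shift_funpow assms])

text \<open>A product of subsets of \<open>S\<close> is closed because the factors are discrete; the basic open sets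
  are such products.\<close>

lemma full_shift_clopen_basis:
  assumes "openin (full_shift S) W" and "p \<in> W"
  obtains B where "openin (full_shift S) B" "closedin (full_shift S) B" "p \<in> B" "B \<subseteq> W"
proof -
  have "\<exists>V. finite {i \<in> UNIV. V i \<noteq> topspace (discrete_topology S)} \<and>
      (\<forall>i\<in>UNIV. openin (discrete_topology S) (V i)) \<and> p \<in> Pi\<^sub>E UNIV V \<and> Pi\<^sub>E UNIV V \<subseteq> W"
    using assms unfolding full_shift_def openin_product_topology_alt by (rule bspec)
  then obtain V where V: "finite {i. V i \<noteq> S}" "\<And>i. V i \<subseteq> S" "p \<in> Pi\<^sub>E UNIV V" "Pi\<^sub>E UNIV V \<subseteq> W"
    by auto
  have "openin (full_shift S) (Pi\<^sub>E UNIV V)"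
    using V(1,2) unfolding full_shift_def openin_PiE_gen by auto
  moreover have "closedin (full_shift S) (Pi\<^sub>E UNIV V)"
    using V(2) unfolding full_shift_def closedin_product_topology by auto
  ultimately show thesis using that V(3,4) by blast
qed

lemma clopen_nbhd_excluding_point:
  assumes Z: "closedin (full_shift S) Z" and p: "p \<notin> Z"
  shows "\<exists>U. openin (full_shift S) U \<and> closedin (full_shift S) U \<and> Z \<subseteq> U \<and> p \<notin> U"
proof (cases "p \<in> topspace (full_shift S)")
  case False
  then show ?thesis
    using closedin_subset[OF Z] by (intro exI[of _ "topspace (full_shift S)"]) auto
next
  case True
  have "openin (full_shift S) (topspace (full_shift S) - Z)"
    using Z by (rule openin_diff[OF openin_topspace])
  then obtain B where B: "openin (full_shift S) B" "closedin (full_shift S) B" "p \<in> B"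
      "B \<subseteq> topspace (full_shift S) - Z"
    using full_shift_clopen_basis True p by (metis DiffI)
  show ?thesis
  proof (intro exI conjI)
    show "openin (full_shift S) (topspace (full_shift S) - B)"
      using B(2) by (rule openin_diff[OF openin_topspace])
    show "closedin (full_shift S) (topspace (full_shift S) - B)"
      using B(1) by (rule closedin_diff[OF closedin_topspace])
  qed (use B(3,4) closedin_subset[OF Z] in auto)
qed

text \<open>Finiteness of the set of subshifts enters through neighbourhoods of this kind: it reduces
  avoiding all unwanted subshifts to avoiding one point of each.\<close>

lemma clopen_nbhd_excluding_finite:
  assumes Z: "closedin (full_shift S) Z" and F: "finite F" "F \<inter> Z = {}"
  shows "\<exists>U. openin (full_shift S) U \<and> closedin (full_shift S) U \<and> Z \<subseteq> U \<and> F \<inter> U = {}"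
  using F
proof (induction F)
  case empty
  then show ?case
    using closedin_subset[OF Z] by (intro exI[of _ "topspace (full_shift S)"]) auto
next
  case (insert p F)
  then obtain U where "openin (full_shift S) U" "closedin (full_shift S) U" "Z \<subseteq> U" "F \<inter> U = {}"
    by auto
  moreover obtain V where "openin (full_shift S) V" "closedin (full_shift S) V" "Z \<subseteq> V" "p \<notin> V"
    using clopen_nbhd_excluding_point[OF Z, of p] insert.prems by auto
  ultimately show ?case
    by (intro exI[of _ "U \<inter> V"]) auto
qed

section \<open>Subshifts and orbit closures\<close>

lemma subshift_closedin: "subshift S X \<Longrightarrow> closedin (full_shift S) X"
  by (simp add: subshift_def)

lemma subshift_subset_topspace: "subshift S X \<Longrightarrow> X \<subseteq> topspace (full_shift S)"
  by (simp add: subshift_closedin closedin_subset)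

lemma subshift_shift: "subshift S X \<Longrightarrow> x \<in> X \<Longrightarrow> shift x \<in> X"
  by (auto simp: subshift_def)

lemma subshift_shift_funpow: "subshift S X \<Longrightarrow> x \<in> X \<Longrightarrow> (shift ^^ n) x \<in> X"
  by (induction n) (auto intro: subshift_shift)

lemma subshift_Int: "subshift S X \<Longrightarrow> subshift S Y \<Longrightarrow> subshift S (X \<inter> Y)"
  unfolding subshift_def by blast

lemma subshift_Union: "finite \<F> \<Longrightarrow> (\<And>Y. Y \<in> \<F> \<Longrightarrow> subshift S Y) \<Longrightarrow> subshift S (\<Union>\<F>)"
  unfolding subshift_def by (auto intro!: closedin_Union)

lemma finite_subshifts_of_quasiminimal:
  assumes "quasiminimal S X"
  shows "finite {Y. subshift S Y \<and> Y \<subseteq> X}"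
proof -
  have "{Y. subshift S Y \<and> Y \<subseteq> X} \<subseteq> insert X {Y. subshift S Y \<and> Y \<subset> X}"
    by auto
  then show ?thesis
    using assms finite_subset unfolding quasiminimal_def by blast
qed

text \<open>All uses of quasiminimality for sequences are instances of the pigeonhole principle.\<close>

lemma subshift_repeats:
  fixes P :: "nat \<Rightarrow> (nat \<Rightarrow> 'a) set"
  assumes "quasiminimal S X" and "\<And>n. subshift S (P n)" and "\<And>n. P n \<subseteq> X"
  obtains j k where "j < k" "P j = P k"
proof -
  have "range P \<subseteq> {Y. subshift S Y \<and> Y \<subseteq> X}"
    using assms(2,3) by auto
  then have "finite (range P)"
    using finite_subshifts_of_quasiminimal[OF assms(1)] by (rule finite_subset)
  then have "\<not> inj P"
    using finite_imageD infinite_UNIV_nat by blast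
  then obtain i j where "i \<noteq> j" "P i = P j"
    by (auto simp: inj_def)
  then show thesis
    using that[of i j] that[of j i] by (cases i j rule: linorder_cases) simp_all
qed

definition orbit_closure :: "'a set \<Rightarrow> (nat \<Rightarrow> 'a) \<Rightarrow> (nat \<Rightarrow> 'a) set" where
  "orbit_closure S x = full_shift S closure_of (range (\<lambda>n. (shift ^^ n) x))"

lemma subshift_orbit_closure: "subshift S (orbit_closure S x)"
proof -
  have "shift ` orbit_closure S x \<subseteq> full_shift S closure_of (shift ` range (\<lambda>n. (shift ^^ n) x))"
    unfolding orbit_closure_def
    by (rule continuous_map_image_closure_subset[OF continuous_map_shift])
  also have "\<dots> \<subseteq> orbit_closure S x"
  proof -
    have "shift ` range (\<lambda>n. (shift ^^ n) x) \<subseteq> range (\<lambda>n. (shift ^^ n) x)"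
    proof (rule image_subsetI)
      fix y assume "y \<in> range (\<lambda>n. (shift ^^ n) x)"
      then obtain n where "y = (shift ^^ n) x" by auto
      then have "shift y = (shift ^^ Suc n) x" by simp
      then show "shift y \<in> range (\<lambda>n. (shift ^^ n) x)" by blast
    qed
    then show ?thesis
      unfolding orbit_closure_def by (rule closure_of_mono)
  qed
  finally show ?thesis
    unfolding subshift_def by (simp add: orbit_closure_def)
qed

lemma orbit_closure_least:
  assumes "subshift S Y" and "x \<in> Y"
  shows "orbit_closure S x \<subseteq> Y"
  unfolding orbit_closure_def
  by (rule closure_of_minimal)
     (use assms in \<open>auto intro: subshift_shift_funpow subshift_closedin\<close>)

lemma in_orbit_closure_self:
  assumes "x \<in> topspace (full_shift S)"
  shows "x \<in> orbit_closure S x"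
proof -
  have "x \<in> range (\<lambda>n. (shift ^^ n) x)"
    by (metis funpow_0 rangeI)
  then show ?thesis
    using assms unfolding orbit_closure_def closure_of_def by blast
qed

lemma orbit_meets_open:
  assumes "z \<in> orbit_closure S x" and "openin (full_shift S) V" and "z \<in> V"
  obtains n where "(shift ^^ n) x \<in> V"
  using assms unfolding orbit_closure_def in_closure_of by blast

text \<open>The image \<open>\<sigma> W\<close> of the compact set \<open>W\<close> is again a subshift. It contains \<open>\<sigma> y\<close>, hence the whole
  orbit closure of \<open>\<sigma> y\<close>, hence \<open>y\<close>, and therefore \<open>W\<close>.\<close>

lemma shift_orbit_closure_recurrent:
  assumes S: "finite S" and y: "y \<in> orbit_closure S (shift y)"
  shows "orbit_closure S y \<subseteq> shift ` orbit_closure S y"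
proof (rule orbit_closure_least)
  let ?W = "orbit_closure S y"
  have ytop: "y \<in> topspace (full_shift S)"
    using y subshift_subset_topspace[OF subshift_orbit_closure] by blast
  have "closedin (full_shift S) (shift ` ?W)"
  proof (rule compactin_imp_closedin[OF Hausdorff_space_full_shift])
    show "compactin (full_shift S) (shift ` ?W)"
      using closedin_compact_space[OF compact_space_full_shift[OF S]
          subshift_closedin[OF subshift_orbit_closure]]
      by (rule image_compactin) (rule continuous_map_shift)
  qed
  moreover have "shift ` ?W \<subseteq> ?W"
    using subshift_shift[OF subshift_orbit_closure] by blast
  ultimately show sub: "subshift S (shift ` ?W)"
    unfolding subshift_def by blast
  show "y \<in> shift ` ?W"
    using orbit_closure_least[OF sub] in_orbit_closure_self[OF ytop] y by blast
qed

section \<open>Recurrent points of quasiminimal subshifts\<close>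

text \<open>If \<open>P\<^sub>n\<close> is the set of points of \<open>W\<close> that lie in \<open>Z\<close> after \<open>n\<close> steps, then \<open>P\<^sub>j = P\<^sub>k\<close> for some
  \<open>j < k\<close>. A point \<open>w\<close> that enters \<open>Z\<close> in one step has a preimage \<open>v\<close> under \<open>\<sigma>\<^sup>j\<close>
  in \<open>W\<close>; it lies in \<open>P\<^sub>k\<close>, hence in \<open>P\<^sub>j\<close>, and this says that \<open>w\<close> lies in \<open>Z\<close>.\<close>

lemma backward_invariant_in_surjective:
  assumes qm: "quasiminimal S X" and W: "subshift S W" "W \<subseteq> X" "W \<subseteq> shift ` W"
    and Z: "subshift S Z" and w: "w \<in> W" "shift w \<in> Z"
  shows "w \<in> Z"
proof -
  define P where "P n = {x \<in> W. (shift ^^ n) x \<in> Z}" for n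
  have "subshift S (P n)" for n
  proof -
    have "P n = W \<inter> {x \<in> topspace (full_shift S). (shift ^^ n) x \<in> Z}"
      using subshift_subset_topspace[OF W(1)] by (auto simp: P_def)
    moreover have "closedin (full_shift S) \<dots>"
      using W(1) Z by (intro closedin_Int closedin_shift_preimage subshift_closedin)
    moreover have "shift ` P n \<subseteq> P n"
      using subshift_shift[OF W(1)] subshift_shift[OF Z]
      by (auto simp: P_def funpow_swap1[symmetric])
    ultimately show ?thesis by (simp add: subshift_def)
  qed
  moreover have "P n \<subseteq> X" for n
    using W(2) by (auto simp: P_def)
  ultimately obtain j k where jk: "j < k" "P j = P k"
    using subshift_repeats[OF qm] by metis
  have "\<exists>v\<in>W. (shift ^^ n) v = w" for n
  proof (induction n)
    case 0
    then show ?case using w(1) by simp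
  next
    case (Suc n)
    then obtain v where v: "v \<in> W" "(shift ^^ n) v = w" by blast
    then obtain u where "u \<in> W" "v = shift u" using W(3) by blast
    then show ?case using v by (auto simp: funpow_swap1)
  qed
  then obtain v where v: "v \<in> W" "(shift ^^ j) v = w" by blast
  have "(shift ^^ k) v = (shift ^^ (k - Suc j)) ((shift ^^ Suc j) v)"
    using jk(1) by (metis Suc_leI comp_apply funpow_add le_add_diff_inverse2)
  also have "\<dots> \<in> Z"
    by (rule subshift_shift_funpow[OF Z]) (simp add: v(2) w(2))
  finally have "v \<in> P j" using v(1) unfolding jk(2) by (simp add: P_def)
  then show ?thesis using v(2) by (simp add: P_def)
qed

text \<open>The points of \<open>X\<close> whose orbit stays in a closed set \<open>U\<close> form a subshift. If \<open>U\<close> misses one point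
  of each subshift of \<open>X\<close> that is not contained in \<open>Z\<close>, this one must be contained in \<open>Z\<close>. The
  given point \<open>y\<close> can be excluded from \<open>U\<close> at the same time.\<close>

lemma isolating_clopen_nbhd:
  assumes qm: "quasiminimal S X" and Z: "subshift S Z" and y: "y \<notin> Z"
  obtains U where "openin (full_shift S) U" "closedin (full_shift S) U" "Z \<subseteq> U" "y \<notin> U"
    "\<And>x. x \<in> X \<Longrightarrow> (\<And>n. (shift ^^ n) x \<in> U) \<Longrightarrow> x \<in> Z"
proof -
  define \<F> where "\<F> = {Y. subshift S Y \<and> Y \<subseteq> X \<and> \<not> Y \<subseteq> Z}"
  have "finite \<F>"
    by (rule finite_subset[OF _ finite_subshifts_of_quasiminimal[OF qm]]) (auto simp: \<F>_def)
  obtain p where p: "\<And>Y. Y \<in> \<F> \<Longrightarrow> p Y \<in> Y - Z"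
    using bchoice[of \<F> "\<lambda>Y q. q \<in> Y - Z"] by (auto simp: \<F>_def)
  have "finite (insert y (p ` \<F>))" "insert y (p ` \<F>) \<inter> Z = {}"
    using \<open>finite \<F>\<close> p y by auto
  then obtain U where U: "openin (full_shift S) U" "closedin (full_shift S) U" "Z \<subseteq> U"
      "insert y (p ` \<F>) \<inter> U = {}"
    using clopen_nbhd_excluding_finite[OF subshift_closedin[OF Z]] by metis
  have X: "subshift S X" using qm by (simp add: quasiminimal_def)
  define R where "R = {x \<in> X. \<forall>n. (shift ^^ n) x \<in> U}"
  have "R = X \<inter> (\<Inter>n. {x \<in> topspace (full_shift S). (shift ^^ n) x \<in> U})"
    using subshift_subset_topspace[OF X] by (auto simp: R_def)
  moreover have "closedin (full_shift S) \<dots>"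
    using U(2) subshift_closedin[OF X]
    by (intro closedin_Int closedin_INT closedin_shift_preimage) auto
  moreover have "shift ` R \<subseteq> R"
  proof (rule image_subsetI)
    fix x assume x: "x \<in> R"
    then have "(shift ^^ Suc n) x \<in> U" for n
      unfolding R_def by blast
    then show "shift x \<in> R"
      using x subshift_shift[OF X] unfolding R_def by (simp add: funpow_swap1)
  qed
  ultimately have "subshift S R" by (simp add: subshift_def)
  moreover have "R \<subseteq> U"
  proof
    fix x assume "x \<in> R"
    then have "(shift ^^ 0) x \<in> U" unfolding R_def by blast
    then show "x \<in> U" by simp
  qed
  ultimately have "R \<subseteq> Z"
    using p U(4) unfolding \<F>_def R_def by blast
  then have "x \<in> Z" if "x \<in> X" "\<And>n. (shift ^^ n) x \<in> U" for x
    using that unfolding R_def by blast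
  moreover have "y \<notin> U"
    using U(4) by blast
  ultimately show thesis
    using that U(1-3) by blast
qed

text \<open>In a shift-surjective \<open>W\<close>, a point cannot enter \<open>Z\<close> from outside, and by compactness it
  cannot enter the isolating neighbourhood \<open>U\<close> for an arbitrarily long visit either: some \<open>m\<close>
  bounds the length of all visits that begin with an entry into \<open>U\<close>. An orbit that starts
  outside \<open>U\<close> therefore stays away from \<open>Z\<close>, so \<open>Z\<close> is disjoint from the orbit closure.\<close>

lemma minimal_orbit_closure_recurrent:
  assumes S: "finite S" and qm: "quasiminimal S X" and y: "y \<in> X" "y \<in> orbit_closure S (shift y)"
  shows "minimal_subshift S (orbit_closure S y)"
proof -
  let ?T = "full_shift S" and ?W = "orbit_closure S y"
  have X: "subshift S X" using qm by (simp add: quasiminimal_def)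
  have WX: "?W \<subseteq> X" by (rule orbit_closure_least[OF X y(1)])
  have Wtop: "?W \<subseteq> topspace ?T" by (rule subshift_subset_topspace[OF subshift_orbit_closure])
  have "Z = ?W" if Z: "subshift S Z" "Z \<subseteq> ?W" "Z \<noteq> {}" for Z
  proof (rule ccontr)
    assume "Z \<noteq> ?W"
    then have "y \<notin> Z"
      using orbit_closure_least[OF Z(1)] Z(2) by blast
    then obtain U where U: "openin ?T U" "closedin ?T U" "Z \<subseteq> U" "y \<notin> U"
        "\<And>x. x \<in> X \<Longrightarrow> (\<And>n. (shift ^^ n) x \<in> U) \<Longrightarrow> x \<in> Z"
      using isolating_clopen_nbhd[OF qm Z(1)] by metis
    \<comment> \<open>The points from which the orbit enters \<open>U\<close> and stays there for at least \<open>m\<close> steps.\<close>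
    define A where "A m = {w \<in> ?W. w \<notin> U \<and> (\<forall>i\<in>{1..m}. (shift ^^ i) w \<in> U)}" for m
    have "\<exists>m. A m = {}"
    proof (rule ccontr)
      assume nonempty: "\<nexists>m. A m = {}"
      have "closedin ?T (A m)" for m
      proof -
        have "A m = (?W \<inter> (topspace ?T - U)) \<inter>
            (topspace ?T \<inter> (\<Inter>i\<in>{1..m}. {x \<in> topspace ?T. (shift ^^ i) x \<in> U}))"
          using Wtop by (auto simp: A_def)
        \<comment> \<open>For \<open>m = 0\<close> the intersection over the empty index set is the whole type, not the space.\<close>
        moreover have "closedin ?T (topspace ?T \<inter> (\<Inter>i\<in>{1..m}. {x \<in> topspace ?T. (shift ^^ i) x \<in> U}))"
        proof (cases "m = 0")
          case False
          then show ?thesis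
            using U(2) by (intro closedin_Int closedin_INT closedin_shift_preimage) auto
        qed simp
        ultimately show ?thesis
          using U(1) subshift_closedin[OF subshift_orbit_closure, of S y]
          by (auto intro!: closedin_Int)
      qed
      moreover have "decseq A"
        by (rule decseq_SucI) (auto simp: A_def)
      ultimately have "(\<Inter>m. A m) \<noteq> {}"
        using nonempty compact_space_imp_nest[OF compact_space_full_shift[OF S]] by blast
      then obtain w where w: "\<And>m. w \<in> A m" by blast
      have "(shift ^^ n) (shift w) \<in> U" for n
      proof -
        have "Suc n \<in> {1..Suc n}" by simp
        then have "(shift ^^ Suc n) w \<in> U"
          using w[of "Suc n"] unfolding A_def by blast
        then show ?thesis by (simp add: funpow_swap1)
      qed
      moreover have wW: "w \<in> ?W" "w \<notin> U" using w[of 0] by (auto simp: A_def)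
      ultimately have "shift w \<in> Z"
        using U(5) WX subshift_shift[OF X] by blast
      then have "w \<in> Z"
        using backward_invariant_in_surjective[OF qm subshift_orbit_closure WX
            shift_orbit_closure_recurrent[OF S y(2)] Z(1) wW(1)] by blast
      then show False using U(3) wW(2) by blast
    qed
    then obtain m where m: "A m = {}" ..
    have yW: "y \<in> ?W"
      using in_orbit_closure_self y(1) subshift_subset_topspace[OF X] by blast
    \<comment> \<open>Since \<open>A m\<close> is empty, \<open>m\<close> consecutive orbit points in \<open>U\<close> force the preceding one into \<open>U\<close>.\<close>
    have backtrack: "y \<in> U" if "\<forall>i\<in>{0..m}. (shift ^^ (n + i)) y \<in> U" for n
      using that
    proof (induction n)
      case 0
      then show ?case by (auto dest: bspec[of _ _ 0])
    next
      case (Suc n)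
      let ?v = "(shift ^^ n) y"
      have vi: "(shift ^^ i) ?v = (shift ^^ (n + i)) y" for i
        by (simp add: funpow_add add.commute)
      have up: "(shift ^^ (n + i)) y \<in> U" if "i \<in> {1..m}" for i
      proof -
        from that obtain i' where "i = Suc i'" "i' \<in> {0..m}"
          by (cases i) auto
        then show ?thesis using Suc.prems by auto
      qed
      moreover have "?v \<in> ?W"
        using subshift_shift_funpow[OF subshift_orbit_closure yW] .
      ultimately have "?v \<in> U"
        using m vi unfolding A_def by auto
      then have "(shift ^^ (n + i)) y \<in> U" if "i \<in> {0..m}" for i
        using up that by (cases "i = 0") auto
      then show ?case using Suc.IH by blast
    qed
    \<comment> \<open>A neighbourhood of \<open>Z\<close> whose points spend the times \<open>0, \<dots>, m\<close> in \<open>U\<close>: the orbit of \<open>y\<close>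
      must visit it.\<close>
    define V where "V = (\<Inter>i\<in>{0..m}. {x \<in> topspace ?T. (shift ^^ i) x \<in> U})"
    have "openin ?T V"
      unfolding V_def using U(1) by (intro openin_INT2 openin_shift_preimage) auto
    moreover obtain z where "z \<in> Z" using Z(3) by blast
    moreover have "Z \<subseteq> V"
      using subshift_subset_topspace[OF Z(1)] subshift_shift_funpow[OF Z(1)] U(3)
      by (auto simp: V_def)
    ultimately obtain n where "(shift ^^ n) y \<in> V"
      using orbit_meets_open Z(2) by blast
    then have "\<forall>i\<in>{0..m}. (shift ^^ (n + i)) y \<in> U"
      by (auto simp: V_def funpow_add add.commute)
    then show False using backtrack U(4) by blast
  qed
  then show ?thesis
    unfolding minimal_subshift_def using subshift_orbit_closure by blast
qed

section \<open>The points outside the minimal subshifts\<close>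

text \<open>If the points at times \<open>j < k\<close> of an orbit have the same orbit closure, the point \<open>y\<close> at time
  \<open>j\<close> is recurrent: \<open>y\<close> lies in the orbit closure of the later point, hence in that of \<open>\<sigma> y\<close>.\<close>

lemma eventually_in_minimal_subshift:
  assumes S: "finite S" and qm: "quasiminimal S X" and x: "x \<in> X"
  obtains n Y where "minimal_subshift S Y" "Y \<subseteq> X" "(shift ^^ n) x \<in> Y"
proof -
  have X: "subshift S X" using qm by (simp add: quasiminimal_def)
  have orb: "(shift ^^ n) x \<in> X" for n
    by (rule subshift_shift_funpow[OF X x])
  then have "orbit_closure S ((shift ^^ n) x) \<subseteq> X" for n
    by (rule orbit_closure_least[OF X])
  then obtain j k where jk: "j < k"
      "orbit_closure S ((shift ^^ j) x) = orbit_closure S ((shift ^^ k) x)"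
    using subshift_repeats[OF qm, of "\<lambda>n. orbit_closure S ((shift ^^ n) x)"]
      subshift_orbit_closure by metis
  let ?y = "(shift ^^ j) x"
  have self: "(shift ^^ n) x \<in> orbit_closure S ((shift ^^ n) x)" for n
    using in_orbit_closure_self orb subshift_subset_topspace[OF X] by blast
  have "(shift ^^ k) x = (shift ^^ (k - Suc j)) (shift ?y)"
    using jk(1) by (metis Suc_leI comp_apply funpow.simps(2) funpow_add le_add_diff_inverse2)
  also have "\<dots> \<in> orbit_closure S (shift ?y)"
    by (rule subshift_shift_funpow[OF subshift_orbit_closure]) (use self[of "Suc j"] in simp)
  finally have "?y \<in> orbit_closure S (shift ?y)"
    using orbit_closure_least[OF subshift_orbit_closure] jk(2) self[of j] by blast
  then show thesis
    using that minimal_orbit_closure_recurrent[OF S qm orb] orbit_closure_least[OF X orb] self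
    by blast
qed

text \<open>Distinct points \<open>x\<close> outside \<open>M\<close> yield distinct subshifts \<open>M \<union> {x, \<sigma> x, \<dots>}\<close>; these are
  closed because all but finitely many points of the orbit lie in \<open>M\<close>.\<close>

lemma finite_outside_absorbing_subshift:
  assumes qm: "quasiminimal S X" and M: "subshift S M" "M \<subseteq> X"
    and enter: "\<And>x. x \<in> X \<Longrightarrow> \<exists>n. (shift ^^ n) x \<in> M"
  shows "finite (X - M)"
proof -
  have X: "subshift S X" using qm by (simp add: quasiminimal_def)
  define G where "G x = M \<union> range (\<lambda>n. (shift ^^ n) x)" for x
  have stay: "(shift ^^ n) x \<in> M" if "(shift ^^ m) x \<in> M" "m \<le> n" for m n x
    using subshift_shift_funpow[OF M(1) that(1), of "n - m"] that(2)
    by (metis comp_apply funpow_add le_add_diff_inverse2)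
  have "subshift S (G x)" "G x \<subseteq> X" if x: "x \<in> X" for x
  proof -
    show "G x \<subseteq> X"
      using M(2) subshift_shift_funpow[OF X x] by (auto simp: G_def)
    obtain n where "(shift ^^ n) x \<in> M" using enter[OF x] ..
    then have "G x = M \<union> (\<lambda>i. (shift ^^ i) x) ` {..<n}"
      using stay by (auto simp: G_def) (metis imageI lessThan_iff linorder_not_le)
    moreover have "closedin (full_shift S) ((\<lambda>i. (shift ^^ i) x) ` {..<n})"
      using subshift_shift_funpow[OF X x] subshift_subset_topspace[OF X]
      by (intro closedin_Hausdorff_finite[OF Hausdorff_space_full_shift]) auto
    ultimately have "closedin (full_shift S) (G x)"
      using subshift_closedin[OF M(1)] by auto
    moreover have "shift y \<in> G x" if "y \<in> G x" for y
      using that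
    proof (unfold G_def, elim UnE rangeE)
      fix i assume "y = (shift ^^ i) x"
      then have "shift y = (shift ^^ Suc i) x" by simp
      then show "shift y \<in> M \<union> range (\<lambda>n. (shift ^^ n) x)" by blast
    qed (use subshift_shift[OF M(1)] in blast)
    ultimately show "subshift S (G x)"
      unfolding subshift_def by blast
  qed
  then have "finite (G ` (X - M))"
    by (intro finite_subset[OF _ finite_subshifts_of_quasiminimal[OF qm]]) auto
  moreover have "inj_on G (X - M)"
  proof (rule inj_onI)
    fix x y assume x: "x \<in> X - M" and y: "y \<in> X - M" and G: "G x = G y"
    have self: "v \<in> G v" for v
      unfolding G_def by (metis UnCI funpow_0 rangeI)
    obtain i where i: "x = (shift ^^ i) y"
      using self[of x] G x by (auto simp: G_def)
    obtain j where j: "y = (shift ^^ j) x"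
      using self[of y] G y by (auto simp: G_def)
    \<comment> \<open>The point \<open>x\<close> returns to itself after \<open>q\<close> steps, which is impossible outside \<open>M\<close> unless \<open>q = 0\<close>.\<close>
    define q where "q = i + j"
    have per: "(shift ^^ q) x = x"
      using i j by (simp add: q_def funpow_add)
    have per_mult: "(shift ^^ (q * n)) x = x" for n
      by (induction n) (simp_all add: funpow_add per)
    obtain n where n: "(shift ^^ n) x \<in> M" using enter x by blast
    have "q = 0"
    proof (rule ccontr)
      assume "q \<noteq> 0"
      then have "n \<le> q * n" by simp
      then have "(shift ^^ (q * n)) x \<in> M" by (rule stay[OF n])
      then show False using per_mult x by simp
    qed
    then show "x = y" using i by (simp add: q_def)
  qed
  ultimately show ?thesis by (rule finite_imageD)
qed

section \<open>The two directions of the characterization\<close>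

lemma enumerate_by_decreasing_rank:
  fixes h :: "'b \<Rightarrow> nat"
  assumes "finite A"
  shows "\<exists>(l::nat) x. A = x ` {1..l} \<and> (\<forall>i\<in>{1..l}. \<forall>j\<in>{1..l}. h (x i) < h (x j) \<longrightarrow> j < i)"
proof -
  obtain zs where zs: "set zs = A" using finite_list[OF assms] by blast
  define xs where "xs = rev (sort_key h zs)"
  have set: "set xs = A" by (simp add: xs_def zs)
  have "sorted (rev (map h xs))" by (simp add: xs_def rev_map)
  then have mono: "h (xs ! j) \<le> h (xs ! i)" if "i \<le> j" "j < length xs" for i j
    using that by (auto simp: sorted_rev_iff_nth_mono)
  show ?thesis
  proof (intro exI[of _ "length xs"] exI[of _ "\<lambda>i. xs ! (i - 1)"] conjI ballI impI)
    have "{1..length xs} = Suc ` {..<length xs}"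
      by (simp add: image_Suc_lessThan)
    then have "(\<lambda>i. xs ! (i - 1)) ` {1..length xs} = (!) xs ` {..<length xs}"
      by (simp add: image_image)
    also have "\<dots> = A"
      using set by (auto simp: set_conv_nth)
    finally show "A = (\<lambda>i. xs ! (i - 1)) ` {1..length xs}" ..
  next
    fix i j
    assume i: "i \<in> {1..length xs}" and j: "j \<in> {1..length xs}"
      and less: "h (xs ! (i - 1)) < h (xs ! (j - 1))"
    show "j < i"
    proof (rule ccontr)
      assume "\<not> j < i"
      then have "i - 1 \<le> j - 1" "j - 1 < length xs"
        using i j by auto
      then show False
        using mono less by (meson not_le)
    qed
  qed
qed

lemma quasiminimal_imp_decomposition:
  fixes S :: "'a set"
  assumes S: "finite S" and qm: "quasiminimal S X"
  obtains k l :: nat and Y x where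
    "\<forall>i\<in>{1..k}. minimal_subshift S (Y i)"
    "X = (\<Union>i\<in>{1..k}. Y i) \<union> x ` {1..l}"
    "\<forall>i\<in>{1..l}. shift (x i) \<in> (\<Union>j\<in>{1..k}. Y j) \<or> shift (x i) \<in> x ` {i+1..l}"
proof -
  have X: "subshift S X" using qm by (simp add: quasiminimal_def)
  define \<M> where "\<M> = {Y. minimal_subshift S Y \<and> Y \<subseteq> X}"
  define M where "M = \<Union>\<M>"
  have fin: "finite \<M>"
    by (rule finite_subset[OF _ finite_subshifts_of_quasiminimal[OF qm]])
       (auto simp: \<M>_def minimal_subshift_def)
  obtain k and Y :: "nat \<Rightarrow> (nat \<Rightarrow> 'a) set" where Y: "\<M> = Y ` {1..k}"
    using enumerate_by_decreasing_rank[OF fin, of "\<lambda>_. 0"] by blast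
  have MY: "M = (\<Union>i\<in>{1..k}. Y i)" by (simp add: M_def Y)
  have M: "subshift S M" "M \<subseteq> X"
    unfolding M_def using fin by (auto simp: \<M>_def minimal_subshift_def intro!: subshift_Union)
  have enter: "\<exists>n. (shift ^^ n) x \<in> M" if "x \<in> X" for x
    using eventually_in_minimal_subshift[OF S qm that] unfolding M_def \<M>_def by blast
  \<comment> \<open>Outside \<open>M\<close> the entry time drops along the orbit, so decreasing entry time is the required
    order.\<close>
  define h where "h x = (LEAST n. (shift ^^ n) x \<in> M)" for x
  have h_shift: "h (shift x) < h x" if x: "x \<in> X - M" for x
  proof -
    have hx: "(shift ^^ h x) x \<in> M"
      unfolding h_def using enter[of x] x by (meson DiffD1 LeastI_ex)
    then obtain n where n: "h x = Suc n"
      using x by (cases "h x") auto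
    then have "(shift ^^ n) (shift x) \<in> M"
      using hx by (simp add: funpow_swap1)
    then have "h (shift x) \<le> n" unfolding h_def by (rule Least_le)
    then show ?thesis using n by simp
  qed
  have "finite (X - M)"
    by (rule finite_outside_absorbing_subshift[OF qm M enter])
  from enumerate_by_decreasing_rank[OF this, of h]
  obtain l :: nat and x where x: "X - M = x ` {1..l}"
      "\<forall>i\<in>{1..l}. \<forall>j\<in>{1..l}. h (x i) < h (x j) \<longrightarrow> j < i"
    by (elim exE conjE)
  show thesis
  proof (rule that[of k Y x l])
    show "\<forall>i\<in>{1..k}. minimal_subshift S (Y i)"
      using Y unfolding \<M>_def by blast
    show "X = (\<Union>i\<in>{1..k}. Y i) \<union> x ` {1..l}"
      using M(2) x(1) MY by blast
    show "\<forall>i\<in>{1..l}. shift (x i) \<in> (\<Union>j\<in>{1..k}. Y j) \<or> shift (x i) \<in> x ` {i+1..l}"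
    proof
      fix i assume i: "i \<in> {1..l}"
      then have xi: "x i \<in> X - M" using x(1) by blast
      show "shift (x i) \<in> (\<Union>j\<in>{1..k}. Y j) \<or> shift (x i) \<in> x ` {i+1..l}"
      proof (cases "shift (x i) \<in> M")
        case False
        then have "shift (x i) \<in> X - M"
          using xi subshift_shift[OF X] by blast
        then obtain j where j: "j \<in> {1..l}" "shift (x i) = x j"
          using x(1) by blast
        then have "i < j" using x(2) i j h_shift[OF xi] by simp
        then show ?thesis using j by auto
      qed (simp add: MY)
    qed
  qed
qed

lemma decomposition_imp_quasiminimal:
  assumes X: "subshift S X" and \<M>: "finite \<M>" "\<And>Y. Y \<in> \<M> \<Longrightarrow> minimal_subshift S Y"
    and F: "finite F" and eq: "X = \<Union>\<M> \<union> F"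
  shows "quasiminimal S X"
proof -
  have "Z \<in> (\<lambda>(\<N>, E). \<Union>\<N> \<union> E) ` (Pow \<M> \<times> Pow F)" if Z: "subshift S Z" "Z \<subseteq> X" for Z
  proof -
    have all_or_none: "Z \<inter> Y = {} \<or> Y \<subseteq> Z" if "Y \<in> \<M>" for Y
    proof -
      have "subshift S (Z \<inter> Y)"
        using \<M>(2)[OF that] Z(1) by (auto simp: minimal_subshift_def intro: subshift_Int)
      then show ?thesis
        using \<M>(2)[OF that] unfolding minimal_subshift_def by (metis inf.cobounded2 inf.orderI inf_commute)
    qed
    have "Z \<subseteq> \<Union>{Y \<in> \<M>. Y \<subseteq> Z} \<union> (Z \<inter> F)"
    proof
      fix z assume "z \<in> Z"
      then consider "z \<in> F" | Y where "Y \<in> \<M>" "z \<in> Y"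
        using Z(2) eq by auto
      then show "z \<in> \<Union>{Y \<in> \<M>. Y \<subseteq> Z} \<union> (Z \<inter> F)"
        using \<open>z \<in> Z\<close> all_or_none by cases auto
    qed
    then have "Z = \<Union>{Y \<in> \<M>. Y \<subseteq> Z} \<union> (Z \<inter> F)"
      by auto
    then show ?thesis by (intro image_eqI[of _ _ "({Y \<in> \<M>. Y \<subseteq> Z}, Z \<inter> F)"]) auto
  qed
  then have "{Z. subshift S Z \<and> Z \<subset> X} \<subseteq> (\<lambda>(\<N>, E). \<Union>\<N> \<union> E) ` (Pow \<M> \<times> Pow F)"
    by (intro subsetI) (simp only: mem_Collect_eq psubset_eq)
  moreover have "finite ((\<lambda>(\<N>, E). \<Union>\<N> \<union> E) ` (Pow \<M> \<times> Pow F))"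
    using \<M>(1) F by simp
  ultimately have "finite {Z. subshift S Z \<and> Z \<subset> X}"
    by (rule finite_subset)
  then show ?thesis
    using X by (simp add: quasiminimal_def)
qed

theorem theorem10:
  fixes S :: "'a set" and X :: "(nat \<Rightarrow> 'a) set"
  assumes "finite S" and "subshift S X"
  shows "quasiminimal S X \<longleftrightarrow>
    (\<exists>(k::nat) (l::nat) (Y :: nat \<Rightarrow> (nat \<Rightarrow> 'a) set) (x :: nat \<Rightarrow> (nat \<Rightarrow> 'a)).
       (\<forall>i\<in>{1..k}. minimal_subshift S (Y i)) \<and>
       X = (\<Union>i\<in>{1..k}. Y i) \<union> x ` {1..l} \<and>
       (\<forall>i\<in>{1..l}. shift (x i) \<in> (\<Union>j\<in>{1..k}. Y j) \<or> shift (x i) \<in> x ` {i+1..l}))"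
    (is "_ \<longleftrightarrow> ?decomposition")
proof
  assume qm: "quasiminimal S X"
  show ?decomposition
    by (rule quasiminimal_imp_decomposition[OF assms(1) qm]) blast
next
  assume ?decomposition
  then obtain k l :: nat and Y x where "\<forall>i\<in>{1..k}. minimal_subshift S (Y i)"
      "X = (\<Union>i\<in>{1..k}. Y i) \<union> x ` {1..l}"
    by blast
  then show "quasiminimal S X"
    by (intro decomposition_imp_quasiminimal[OF assms(2), of "Y ` {1..k}" "x ` {1..l}"]) auto
qed

end
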